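(* For every integer $n\ge 0$, \[A_{3}(n)=\tfrac{1}{3}\,\sigma(3n+2).\] Equivalently, if $3n+2=\prod_{i=1}^{s}p_{i}^{\alpha_i}$ is the prime factorization of $3n+2$, then \[A_{3}(n)=\frac{1}{3}\prod_{i=1}^{s}\frac{p_{i}^{\alpha_{i}+1}-1}{p_i-1}.\]
   Context: A partition $\lambda$ of a nonnegative integer is called a $3$-core if none of its hook lengths is divisible by $3$. $A_3(n)$ denotes the number of partition pairs of $n$ with $3$-cores, i.e. the number of ordered pairs $(\lambda_1,\lambda_2)$ of partitions, each a $3$-core, whose sizes sum to $n$; equivalently $\sum_{n\ge0}A_3(n)q^n=\frac{(q^3;q^3)_\infty^{6}}{(q;q)_\infty^{2}}$, where $(a;q)_\infty=\prod_{k\ge0}(1-aq^k)$. $\sigma(m)$ denotes the sum of the positive divisors of $m$. *)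

theory Defs
  imports Complex_Main
begin

definition is_partition :: "nat list \<Rightarrow> bool" where
  "is_partition xs \<longleftrightarrow> sorted_wrt (\<ge>) xs \<and> (\<forall>x\<in>set xs. 0 < x)"

text \<open>Length of column j (0-indexed) of the Young diagram, i.e. the conjugate part.\<close>
definition conj_part :: "nat list \<Rightarrow> nat \<Rightarrow> nat" where
  "conj_part xs j = length (filter (\<lambda>x. j < x) xs)"

text \<open>Hook length of the cell (i,j) (0-indexed, j < xs!i): arm + leg + 1.\<close>
definition hook_length :: "nat list \<Rightarrow> nat \<Rightarrow> nat \<Rightarrow> nat" where
  "hook_length xs i j = (xs ! i - j - 1) + (conj_part xs j - i - 1) + 1"

definition is_core :: "nat \<Rightarrow> nat list \<Rightarrow> bool" where
  "is_core t xs \<longleftrightarrow> (\<forall>i < length xs. \<forall>j < xs ! i. \<not> t dvd hook_length xs i j)"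

definition A3 :: "nat \<Rightarrow> nat" where
  "A3 n = card {(a, b). is_partition a \<and> is_partition b \<and> is_core 3 a \<and> is_core 3 b
                        \<and> sum_list a + sum_list b = n}"

definition sigma :: "nat \<Rightarrow> nat" where
  "sigma m = (\<Sum>d \<in> {d. d dvd m}. d)"

end

theory Submission
  imports Defs "HOL-Number_Theory.Number_Theory" "HOL-Library.Discrete_Functions"
begin

text \<open>
  Let \<open>\<chi>\<close> be the nontrivial character mod 3 and \<open>f(N) = \<Sum>\<^sub>d\<^sub>|\<^sub>N \<chi>(d)\<close>.
  The first-column hook lengths of a 3-core are \<open>1, 4, \<dots>, 3i - 2\<close> and \<open>2, 5, \<dots>, 3j - 1\<close>,
  so 3-cores correspond to pairs \<open>(i, j)\<close> of naturals, with size \<open>i\<^sup>2 - ij + j\<^sup>2 + j\<close>.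
  This quadratic form has an affine symmetry of order three for which the quadrant is a fundamental
  domain, and three times it plus one is the norm of the Eisenstein integer
  \<open>(i + j + 1) + (2i - j)\<omega>\<close>; hence \<open>3m + 1\<close> is six times as often an Eisenstein norm as
  there are 3-cores of \<open>m\<close>. The number of Eisenstein integers of norm \<open>N\<close>, for \<open>N\<close> prime to 3,
  and \<open>6 f(N)\<close> satisfy the same recurrence in each prime factor of \<open>N\<close>, so there are \<open>f(3m + 1)\<close>
  such 3-cores.

  Since \<open>f\<close> vanishes on the class 2 mod 3, the claim becomes
  \<open>\<Sum>\<^sub>u\<^sub>+\<^sub>v\<^sub>=\<^sub>N f(u) f(v) = \<sigma>(N) / 3\<close> for \<open>N = 3n + 2\<close>, a case of
  Liouville's method: with \<open>\<chi>(a) \<chi>(b) = [3 | a - b] - [3 | a + b]\<close>, the solutions of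
  \<open>ax + by = N\<close> contributing to the two terms cancel under linear substitutions up to those with
  \<open>a = b\<close> and those of \<open>ky + aw = N\<close> with \<open>3 | k\<close> and \<open>y = w\<close>.
\<close>

section \<open>A convolution identity of Liouville type\<close>

definition chi3 :: "nat \<Rightarrow> int" where
  "chi3 d = (if d mod 3 = 1 then 1 else if d mod 3 = 2 then - 1 else 0)"

lemma chi3_cases:
  "d mod 3 = 0 \<and> chi3 d = 0 \<or> d mod 3 = 1 \<and> chi3 d = 1 \<or> d mod 3 = 2 \<and> chi3 d = - 1"
  unfolding chi3_def by presburger

lemma chi3_mult: "chi3 (a * b) = chi3 a * chi3 b"
  using chi3_cases[of a] chi3_cases[of b] unfolding chi3_def
  by (auto simp: mod_mult_eq[of a 3 b, symmetric])

definition chi3_sum :: "nat \<Rightarrow> int" where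
  "chi3_sum n = (\<Sum>d | d dvd n. chi3 d)"

text \<open>The involution sending \<open>d\<close> to \<open>n div d\<close> flips the sign of
  \<open>chi3 d\<close>, because \<open>chi3 n = - 1\<close>.\<close>

lemma chi3_sum_eq_0:
  assumes "n mod 3 = 2"
  shows "chi3_sum n = 0"
proof -
  have n: "n > 0" using assms by (cases n) auto
  have "chi3_sum n = (\<Sum>d | d dvd n. chi3 (n div d))"
    unfolding chi3_sum_def
    by (rule sum.reindex_bij_witness[of _ "\<lambda>d. n div d" "\<lambda>d. n div d"]) (use n in auto)
  also have "\<dots> = (\<Sum>d | d dvd n. - chi3 d)"
  proof (rule sum.cong[OF refl], clarsimp)
    fix d assume "d dvd n"
    then have "chi3 d * chi3 (n div d) = chi3 n"
      by (simp flip: chi3_mult)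
    moreover have "chi3 n = - 1" using assms by (simp add: chi3_def)
    ultimately show "chi3 (n div d) = - chi3 d"
      using chi3_cases[of d] chi3_cases[of "n div d"] by auto
  qed
  also have "\<dots> = - chi3_sum n"
    by (simp add: chi3_sum_def sum_negf)
  finally show ?thesis by simp
qed

section \<open>Representations of a number as a sum of two products\<close>

definition quads :: "nat \<Rightarrow> (nat \<times> nat \<times> nat \<times> nat) set" where
  "quads N = {(a, x, b, y). 0 < a \<and> 0 < x \<and> 0 < b \<and> 0 < y \<and> a * x + b * y = N}"

lemma finite_quads: "finite (quads N)"
proof (rule finite_subset)
  show "quads N \<subseteq> {..N} \<times> {..N} \<times> {..N} \<times> {..N}"
  proof (clarsimp simp: quads_def)
    fix a x b y :: nat
    assume pos: "0 < a" "0 < x" "0 < b" "0 < y"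
    have "i \<le> i * j \<and> j \<le> i * j" if "0 < i" "0 < j" for i j :: nat
      using that by simp
    from this[OF pos(1,2)] this[OF pos(3,4)]
    show "a \<le> a * x + b * y \<and> x \<le> a * x + b * y \<and> b \<le> a * x + b * y \<and> y \<le> a * x + b * y"
      by linarith
  qed
qed simp

text \<open>A quadruple records \<open>u = a * x\<close> and \<open>N - u = b * y\<close> by the
  divisors \<open>a\<close>, \<open>b\<close> and their cofactors. Keeping \<open>u\<close> strictly
  between 0 and \<open>N\<close> makes both divisor sets finite.\<close>

lemma convolution_chi3_sum:
  "(\<Sum>u\<in>{0<..<N}. chi3_sum u * chi3_sum (N - u)) = (\<Sum>(a, x, b, y)\<in>quads N. chi3 a * chi3 b)"
proof -
  have "(\<Sum>u\<in>{0<..<N}. chi3_sum u * chi3_sum (N - u))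
      = (\<Sum>u\<in>{0<..<N}. \<Sum>(a, b)\<in>{a. a dvd u} \<times> {b. b dvd N - u}. chi3 a * chi3 b)"
    unfolding chi3_sum_def sum_product sum.cartesian_product by simp
  also have "\<dots> = (\<Sum>(u, a, b)\<in>(SIGMA u:{0<..<N}. {a. a dvd u} \<times> {b. b dvd N - u}). chi3 a * chi3 b)"
    by (subst sum.Sigma) (auto simp: case_prod_unfold)
  also have "\<dots> = (\<Sum>(a, x, b, y)\<in>quads N. chi3 a * chi3 b)"
    by (rule sum.reindex_bij_witness[of _ "\<lambda>(a, x, b, y). (a * x, a, b)"
          "\<lambda>(u, a, b). (a, u div a, b, (N - u) div b)"])
      (auto simp: quads_def dvd_div_eq_0_iff intro!: Nat.gr0I)
  finally show ?thesis .
qed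

text \<open>For two nonzero residues exactly one bracket is 1, with the sign of the product; for two
  zero residues the brackets cancel; otherwise both are 0.\<close>

lemma chi3_mult_eq_of_bool: "chi3 a * chi3 b = of_bool (a mod 3 = b mod 3) - of_bool (3 dvd a + b)"
proof -
  have "3 dvd a + b \<longleftrightarrow> (a mod 3 + b mod 3) mod 3 = 0"
    by (simp add: mod_add_eq dvd_eq_mod_eq_0)
  then show ?thesis using chi3_cases[of a] chi3_cases[of b]
    by (elim disjE conjE; simp)
qed

text \<open>If \<open>x = y\<close>, then \<open>(a + b) * x = N\<close>: here \<open>d\<close> is
  the divisor \<open>a + b\<close>, and \<open>k\<close> is \<open>a\<close>, which determines
  \<open>b\<close>.\<close>

lemma card_quads_sum_divisors:
  assumes "N > 0"
  shows "card {(a, x, b, y) \<in> quads N. x = y \<and> P a} = (\<Sum>d | d dvd N. card {k. 0 < k \<and> k < d \<and> P k})"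
proof -
  have "(\<Sum>d | d dvd N. card {k. 0 < k \<and> k < d \<and> P k}) = card (SIGMA d:{d. d dvd N}. {k. 0 < k \<and> k < d \<and> P k})"
    using assms by (subst card_SigmaI) auto
  also have "\<dots> = card {(a, x, b, y) \<in> quads N. x = y \<and> P a}"
  proof (rule bij_betw_same_card[of "\<lambda>(d, k). (k, N div d, d - k, N div d)"],
         rule bij_betw_byWitness[where f' = "\<lambda>(a, x, b, y). (a + b, a)"])
    have fwd: "(k, N div d, d - k, N div d) \<in> quads N" if "d dvd N" "0 < k" "k < d" for d k
    proof -
      have "k * (N div d) + (d - k) * (N div d) = d * (N div d)"
        using that by (simp flip: distrib_right)
      then show ?thesis using that assms by (auto simp: quads_def dvd_div_eq_0_iff intro!: Nat.gr0I)
    qed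
    have bwd: "a + b dvd N \<and> N div (a + b) = x \<and> 0 < a \<and> 0 < b"
      if "(a, x, b, x) \<in> quads N" for a x b
    proof -
      have "N = (a + b) * x" "0 < a" "0 < b" using that by (auto simp: quads_def distrib_right)
      then show ?thesis by simp
    qed
    let ?A = "SIGMA d:{d. d dvd N}. {k. 0 < k \<and> k < d \<and> P k}"
    let ?B = "{(a, x, b, y) \<in> quads N. x = y \<and> P a}"
    show "(\<lambda>(d, k). (k, N div d, d - k, N div d)) ` ?A \<subseteq> ?B" using fwd by auto
    show "(\<lambda>(a, x, b, y). (a + b, a)) ` ?B \<subseteq> ?A" using bwd by fastforce
    show "\<forall>q\<in>?B. (\<lambda>(d, k). (k, N div d, d - k, N div d)) ((\<lambda>(a, x, b, y). (a + b, a)) q) = q"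
      using bwd by fastforce
  qed auto
  finally show ?thesis ..
qed

lemma card_pos_below: "card {k. 0 < k \<and> k < d} = d - (1::nat)"
proof -
  have "{k. 0 < k \<and> k < d} = {0<..<d}" by auto
  then show ?thesis by simp
qed

lemma card_multiples_below:
  fixes d :: nat
  assumes "m > 0"
  shows "card {k. 0 < k \<and> k < d \<and> m dvd k} = (d - 1) div m"
proof -
  have *: "m * i < d \<longleftrightarrow> i \<le> (d - 1) div m" if "0 < i" for i
  proof -
    have "m * i < d \<longleftrightarrow> i * m \<le> d - 1"
      using that assms by (cases d) (auto simp: mult.commute less_Suc_eq_le)
    then show ?thesis using assms by (simp add: less_eq_div_iff_mult_less_eq)
  qed
  have "{k. 0 < k \<and> k < d \<and> m dvd k} = (\<lambda>i. m * i) ` {0<..(d - 1) div m}"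
  proof (intro equalityI subsetI)
    fix k assume "k \<in> {k. 0 < k \<and> k < d \<and> m dvd k}"
    then obtain i where "k = m * i" "0 < k" "k < d" by blast
    then show "k \<in> (\<lambda>i. m * i) ` {0<..(d - 1) div m}" using *[of i] by auto
  qed (use * assms in auto)
  moreover have "inj_on (\<lambda>i. m * i) {0<..(d - 1) div m}"
    using assms by (auto simp: inj_on_def)
  ultimately show ?thesis by (simp add: card_image)
qed

text \<open>Write |X| for the cardinality of X. By symmetry |D| - |S| = |D0| + 2 |D1| - 2 |S1|. The
  substitutions and the two splittings of \<open>P\<close> give |D1| - |S1| = |E1| - |P1| = |P2| -
  |E2| - |E0| = - |E0|, so |D0| - 2 |E0| remains.\<close>

lemma liouville_convolution:
  assumes N: "N mod 3 = 2"
  shows "3 * (\<Sum>u\<in>{0<..<N}. chi3_sum u * chi3_sum (N - u)) = int (sigma N)"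
proof -
  have N0: "N > 0" and N3: "\<not> 3 dvd N" using N by presburger+
  let ?Q = "quads N"
  define D where "D = {(a, x, b, y) \<in> ?Q. a mod 3 = b mod 3}"
  define D0 where "D0 = {(a, x, b, y) \<in> ?Q. a = b}"
  define D1 where "D1 = {(a, x, b, y) \<in> ?Q. b < a \<and> a mod 3 = b mod 3}"
  define D2 where "D2 = {(a, x, b, y) \<in> ?Q. a < b \<and> a mod 3 = b mod 3}"
  define S where "S = {(a, x, b, y) \<in> ?Q. 3 dvd a + b}"
  define S1 where "S1 = {(a, x, b, y) \<in> ?Q. 3 dvd a + b \<and> y < x}"
  define S2 where "S2 = {(a, x, b, y) \<in> ?Q. 3 dvd a + b \<and> x < y}"
  \<comment> \<open>The difference a - b on \<open>D1\<close> and the sum a + b on \<open>S1\<close>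
    both become the coefficient \<open>k\<close> divisible by 3. \<open>P\<close> is split once by
    comparing \<open>k\<close> with \<open>a\<close> and once by comparing \<open>y\<close> with
    \<open>w\<close>.\<close>
  define P where "P = {(k, y, a, w) \<in> ?Q. 3 dvd k}"
  define P1 where "P1 = {(k, y, a, w) \<in> ?Q. 3 dvd k \<and> a < k}"
  define P2 where "P2 = {(k, y, a, w) \<in> ?Q. 3 dvd k \<and> k < a}"
  define E1 where "E1 = {(k, y, a, w) \<in> ?Q. 3 dvd k \<and> y < w}"
  define E2 where "E2 = {(k, y, a, w) \<in> ?Q. 3 dvd k \<and> w < y}"
  define E0 where "E0 = {(k, y, a, w) \<in> ?Q. 3 dvd k \<and> y = w}"
  have sub: "X \<subseteq> ?Q \<Longrightarrow> finite X" for X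
    using finite_subset finite_quads by blast
  have fin: "finite D" "finite D0" "finite D1" "finite D2" "finite S" "finite S1" "finite S2"
    "finite P" "finite P1" "finite P2" "finite E0" "finite E1" "finite E2"
    by (rule sub, force simp: D_def D0_def D1_def D2_def S_def S1_def S2_def P_def P1_def P2_def
        E0_def E1_def E2_def)+
  have "(\<Sum>(a, x, b, y)\<in>?Q. chi3 a * chi3 b)
      = (\<Sum>q\<in>?Q. of_bool (q \<in> D)) - (\<Sum>q\<in>?Q. of_bool (q \<in> S))"
    unfolding sum_subtractf[symmetric]
    by (rule sum.cong[OF refl]) (auto simp: chi3_mult_eq_of_bool D_def S_def)
  also have "\<dots> = int (card D) - int (card S)"
  proof -
    have "?Q \<inter> D = D" "?Q \<inter> S = S" by (auto simp: D_def S_def)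
    then show ?thesis by (simp add: of_bool_def sum.If_cases finite_quads)
  qed
  finally have sum: "(\<Sum>(a, x, b, y)\<in>?Q. chi3 a * chi3 b) = int (card D) - int (card S)" .
  have "D = D0 \<union> (D1 \<union> D2)" "D0 \<inter> (D1 \<union> D2) = {}" "D1 \<inter> D2 = {}"
    by (auto simp: D_def D0_def D1_def D2_def)
  then have cD: "card D = card D0 + (card D1 + card D2)"
    using fin by (simp add: card_Un_disjoint)
  have swap: "bij_betw (\<lambda>(a, x, b, y). (b, y, a, x)) X Y"
    if "\<And>a x b y. (a, x, b, y) \<in> X \<longleftrightarrow> (b, y, a, x) \<in> Y" for X Y :: "(nat \<times> nat \<times> nat \<times> nat) set"
    by (rule bij_betw_byWitness[where f' = "\<lambda>(a, x, b, y). (b, y, a, x)"]) (use that in auto)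
  have "card D1 = card D2"
    by (rule bij_betw_same_card, rule swap) (auto simp: D1_def D2_def quads_def)
  have "card S1 = card S2"
    by (rule bij_betw_same_card, rule swap) (auto simp: S1_def S2_def quads_def add.commute)
  \<comment> \<open>The diagonals \<open>x = y\<close> in \<open>S\<close> and, further down,
    \<open>k = a\<close> in \<open>P\<close> are empty: either would make 3 divide
    \<open>N\<close>.\<close>
  have "S = S1 \<union> S2"
  proof -
    have "x \<noteq> y" if "(a, x, b, y) \<in> ?Q" "3 dvd a + b" for a x b y
    proof
      assume "x = y"
      then have "(a + b) * y = N" using that by (simp add: quads_def algebra_simps)
      then show False using that N3 by (metis dvd_mult2)
    qed
    then show ?thesis by (force simp: S_def S1_def S2_def)
  qed
  moreover have "S1 \<inter> S2 = {}" by (auto simp: S1_def S2_def)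
  ultimately have cS: "card S = card S1 + card S2"
    using fin by (simp add: card_Un_disjoint)
  have "P = P1 \<union> P2"
  proof -
    have "k \<noteq> a" if "(k, y, a, w) \<in> ?Q" "3 dvd k" for k y a w
      using that N3 by (auto simp: quads_def)
    then show ?thesis by (force simp: P_def P1_def P2_def)
  qed
  moreover have "P1 \<inter> P2 = {}" by (auto simp: P1_def P2_def)
  ultimately have cP: "card P = card P1 + card P2"
    using fin by (simp add: card_Un_disjoint)
  have "P = E0 \<union> (E1 \<union> E2)" "E0 \<inter> (E1 \<union> E2) = {}" "E1 \<inter> E2 = {}"
    by (auto simp: P_def E0_def E1_def E2_def)
  then have cP': "card P = card E0 + (card E1 + card E2)"
    using fin by (simp add: card_Un_disjoint)
  \<comment> \<open>Here a x + b y = (a - b) x + b (x + y), and b < a keeps the new first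
    coefficient positive.\<close>
  have "bij_betw (\<lambda>(a, x, b, y). (a - b, x, b, x + y)) D1 E1"
    by (rule bij_betw_byWitness[where f' = "\<lambda>(k, y, a, w). (k + a, y, a, w - y)"])
      (auto simp: D1_def E1_def quads_def algebra_simps mod_eq_dvd_iff_nat dest!: less_imp_Suc_add)
  then have D1E1: "card D1 = card E1" by (rule bij_betw_same_card)
  \<comment> \<open>Here a x + b y = (a + b) y + a (x - y), and y < x keeps the last factor
    positive.\<close>
  have "bij_betw (\<lambda>(a, x, b, y). (a + b, y, a, x - y)) S1 P1"
    by (rule bij_betw_byWitness[where f' = "\<lambda>(k, y, a, w). (a, w + y, k - a, y)"])
      (auto simp: S1_def P1_def quads_def algebra_simps dest!: less_imp_Suc_add)
  then have S1P1: "card S1 = card P1" by (rule bij_betw_same_card)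
  \<comment> \<open>Here k y + a w = k (y + w) + (a - k) w, which leaves \<open>k\<close> and its
    divisibility by 3 untouched.\<close>
  have "bij_betw (\<lambda>(k, y, a, w). (k, y + w, a - k, w)) P2 E2"
    by (rule bij_betw_byWitness[where f' = "\<lambda>(k, y, a, w). (k, y - w, a + k, w)"])
      (auto simp: P2_def E2_def quads_def algebra_simps dest!: less_imp_Suc_add)
  then have P2E2: "card P2 = card E2" by (rule bij_betw_same_card)
  \<comment> \<open>Exchanging coefficients and cofactors turns \<open>a = b\<close> into the
    condition \<open>x = y\<close> counted by \<open>card_quads_sum_divisors\<close>.\<close>
  have "bij_betw (\<lambda>(a, x, b, y). (x, a, y, b)) D0 {(a, x, b, y) \<in> ?Q. x = y \<and> True}"
    by (rule bij_betw_byWitness[where f' = "\<lambda>(a, x, b, y). (x, a, y, b)"])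
      (auto simp: D0_def quads_def mult.commute)
  then have cD0: "card D0 = (\<Sum>d | d dvd N. d - 1)"
    using card_quads_sum_divisors[OF N0, of "\<lambda>_. True"] by (simp add: bij_betw_same_card card_pos_below)
  have "E0 = {(k, y, a, w) \<in> ?Q. y = w \<and> 3 dvd k}" by (auto simp: E0_def)
  then have cE0: "card E0 = (\<Sum>d | d dvd N. (d - 1) div 3)"
    by (simp add: card_quads_sum_divisors[OF N0] card_multiples_below)
  have "3 * (\<Sum>u\<in>{0<..<N}. chi3_sum u * chi3_sum (N - u)) = 3 * int (card D0) - 6 * int (card E0)"
  proof -
    have "card D + 2 * card E0 = card D0 + card S"
      using cD cS cP cP' D1E1 S1P1 P2E2 \<open>card D1 = card D2\<close> \<open>card S1 = card S2\<close> by linarith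
    then have "int (card D) + 2 * int (card E0) = int (card D0) + int (card S)"
      by linarith
    then show ?thesis unfolding convolution_chi3_sum sum by (simp add: algebra_simps)
  qed
  also have "\<dots> = (\<Sum>d | d dvd N. 3 * int (d - 1) - 6 * int ((d - 1) div 3))"
    unfolding cD0 cE0 by (simp add: sum_subtractf sum_distrib_left)
  \<comment> \<open>For d = 3q + 1 the summand is 3q = d - 1, and for d = 3q + 2 it is 3q + 3 = d +
    1.\<close>
  also have "\<dots> = (\<Sum>d | d dvd N. int d - chi3 d)"
  proof (rule sum.cong[OF refl])
    fix d assume "d \<in> {d. d dvd N}"
    then have "\<not> 3 dvd d" using N3 dvd_trans by blast
    then consider "d mod 3 = 1" "chi3 d = 1" | "d mod 3 = 2" "chi3 d = - 1"
      using chi3_cases[of d] by auto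
    then show "3 * int (d - 1) - 6 * int ((d - 1) div 3) = int d - chi3 d"
    proof cases
      case 1
      then obtain q where "d = 3 * q + 1" by (metis mod_mult_div_eq add.commute)
      with 1 show ?thesis by simp
    next
      case 2
      then obtain q where "d = 3 * q + 2" by (metis mod_mult_div_eq add.commute)
      with 2 show ?thesis by simp
    qed
  qed
  also have "\<dots> = int (sigma N) - chi3_sum N"
    by (simp add: sum_subtractf sigma_def chi3_sum_def)
  finally show ?thesis using chi3_sum_eq_0[OF N] by simp
qed

section \<open>First-column hook lengths and 3-cores\<close>

text \<open>The set of first-column hook lengths.\<close>
fun beta :: "nat list \<Rightarrow> nat set" where
  "beta [] = {}"
| "beta (x # xs) = insert (x + length xs) (beta xs)"

lemma is_partition_Cons:
  "is_partition (x # xs) \<longleftrightarrow> is_partition xs \<and> 0 < x \<and> (\<forall>y\<in>set xs. y \<le> x)"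
  by (auto simp: is_partition_def)

lemma finite_beta: "finite (beta xs)"
  by (induction xs) auto

text \<open>Any upper bound \<open>x\<close> of the parts is allowed, so that the lemma yields both
  positivity and the comparison with a new first part.\<close>

lemma beta_bounds:
  assumes "is_partition xs" "b \<in> beta xs" "\<forall>y\<in>set xs. y \<le> x"
  shows "0 < b \<and> b < x + length xs"
  using assms by (induction xs) (auto simp: is_partition_Cons)

lemma beta_pos: "is_partition xs \<Longrightarrow> b \<in> beta xs \<Longrightarrow> 0 < b"
  using beta_bounds[of xs b "sum_list xs"] by (simp add: member_le_sum_list)

lemma beta_Cons_less: "is_partition (x # xs) \<Longrightarrow> b \<in> beta xs \<Longrightarrow> b < x + length xs"
  using beta_bounds by (auto simp: is_partition_Cons)

lemma card_beta: "is_partition xs \<Longrightarrow> card (beta xs) = length xs"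
proof (induction xs)
  case (Cons x xs)
  then show ?case using beta_Cons_less[OF Cons.prems]
    by (auto simp: is_partition_Cons finite_beta card_insert_if)
qed simp

text \<open>Each entry is a part plus the number of later parts, and these offsets run through all
  numbers below the length.\<close>

lemma sum_beta: "is_partition xs \<Longrightarrow> \<Sum>(beta xs) = sum_list xs + \<Sum>{..<length xs}"
proof (induction xs)
  case (Cons x xs)
  then have "x + length xs \<notin> beta xs" using beta_Cons_less by blast
  with Cons show ?case by (auto simp: is_partition_Cons finite_beta)
qed simp

text \<open>The cardinality gives the length and the maximum then gives the first part; removing the
  maximum leaves the beta set of the tail.\<close>

lemma beta_inj: "is_partition xs \<Longrightarrow> is_partition ys \<Longrightarrow> beta xs = beta ys \<Longrightarrow> xs = ys"
proof (induction xs arbitrary: ys)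
  case Nil
  then show ?case by (cases ys) auto
next
  case (Cons x xs)
  from Cons.prems obtain y zs where ys: "ys = y # zs" by (cases ys) auto
  have len: "length xs = length zs"
    using card_beta[OF Cons.prems(1)] card_beta[OF Cons.prems(2)] Cons.prems(3) ys by simp
  have mx: "Max (beta (u # us)) = u + length us" if "is_partition (u # us)" for u us
    using beta_Cons_less[OF that] by (intro Max_eqI) (auto simp: finite_beta less_imp_le)
  have "x = y" using mx[OF Cons.prems(1)] mx[of y zs] Cons.prems(2,3) len ys by simp
  have "x + length xs \<notin> beta xs" "y + length zs \<notin> beta zs"
    using beta_Cons_less Cons.prems(1,2) ys by blast+
  then have "beta xs = beta zs"
    using Cons.prems(3) ys \<open>x = y\<close> len by (simp add: insert_ident)
  with Cons.IH[of zs] Cons.prems(1,2) ys \<open>x = y\<close> show ?case by (simp add: is_partition_Cons)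
qed

text \<open>Elements are added in increasing order. A new maximum \<open>b\<close> above
  \<open>A\<close> becomes the first part b - |A|, which is positive because \<open>A\<close> lies
  strictly between 0 and \<open>b\<close>.\<close>

lemma beta_surj:
  assumes "finite B" "0 \<notin> B"
  shows "\<exists>xs. is_partition xs \<and> beta xs = B"
  using assms
proof (induction B rule: finite_linorder_max_induct)
  case empty
  then show ?case by (intro exI[of _ "[]"]) (auto simp: is_partition_def)
next
  case (insert b A)
  then obtain xs where xs: "is_partition xs" "beta xs = A" by auto
  have "A \<subseteq> {0<..<b}" using insert by (auto intro!: Nat.gr0I)
  then have "card A \<le> card {0<..<b}" by (intro card_mono) auto
  then have len: "length xs < b" using card_beta[OF xs(1)] xs(2) insert.prems by auto
  have "\<forall>y\<in>set xs. y + length xs \<le> b"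
  proof (cases xs)
    case (Cons u us)
    then have "u + length us < b" using insert.hyps xs(2) by auto
    then show ?thesis using xs(1) Cons by (auto simp: is_partition_Cons)
  qed simp
  then have "is_partition ((b - length xs) # xs)"
    using len xs(1) by (auto simp: is_partition_Cons)
  moreover have "beta ((b - length xs) # xs) = insert b A" using len xs by simp
  ultimately show ?case by blast
qed

section \<open>Hook lengths read off the beta set\<close>

lemma conj_part_less:
  assumes "is_partition xs" "l < length xs"
  shows "j < xs ! l \<longleftrightarrow> l < conj_part xs j"
  using assms
proof (induction xs arbitrary: l)
  case (Cons x xs)
  have "conj_part xs j = 0" if "\<not> j < x"
    using that Cons.prems by (auto simp: conj_part_def is_partition_Cons filter_empty_conv)
  with Cons show ?case
    by (cases l) (auto simp: conj_part_def is_partition_Cons)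
qed simp

lemma conj_part_le: "conj_part xs j \<le> length xs"
  by (simp add: conj_part_def)

lemma beta_eq_nth: "beta xs = (\<lambda>k. xs ! k + (length xs - k - 1)) ` {..<length xs}"
proof (induction xs)
  case (Cons x xs)
  show ?case unfolding beta.simps Cons.IH
    by (simp add: lessThan_Suc_eq_insert_0 image_image)
qed simp

text \<open>A column \<open>j\<close> of height p corresponds to the number length - p + j. It lies
  strictly between the entries of rows p and p - 1, where these exist, so it is missing from the
  beta set; the hook length is the distance from \<open>b\<close> down to it.\<close>

lemma hook_length_iff:
  assumes xs: "is_partition xs" and k: "k < length xs" and h: "0 < h"
  defines "b \<equiv> xs ! k + (length xs - k - 1)"
  shows "(\<exists>j < xs ! k. hook_length xs k j = h) \<longleftrightarrow> h \<le> b \<and> b - h \<notin> beta xs"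
proof
  assume "\<exists>j < xs ! k. hook_length xs k j = h"
  then obtain j where j: "j < xs ! k" "hook_length xs k j = h" by blast
  define p where "p = conj_part xs j"
  have p: "k < p" "p \<le> length xs"
    using conj_part_less[OF xs k] j(1) conj_part_le by (auto simp: p_def)
  have bh: "b = h + (length xs - p + j)"
    using j k p unfolding b_def hook_length_def p_def by linarith
  moreover have "length xs - p + j \<notin> beta xs"
  proof
    assume "length xs - p + j \<in> beta xs"
    then obtain l where l: "l < length xs" "length xs - p + j = xs ! l + (length xs - l - 1)"
      unfolding beta_eq_nth by auto
    show False
      using conj_part_less[OF xs l(1), of j] l p unfolding p_def[symmetric] by linarith
  qed
  ultimately show "h \<le> b \<and> b - h \<notin> beta xs" by simp
next
  assume *: "h \<le> b \<and> b - h \<notin> beta xs"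
  define v where "v = b - h"
  let ?f = "\<lambda>l. xs ! l + (length xs - l - 1)"
  \<comment> \<open>This \<open>p\<close> is the number of entries above the gap \<open>v\<close>.
    The guard makes \<open>length xs\<close> itself admissible, so that the minimum exists even if
    all entries exceed \<open>v\<close>.\<close>
  define p where "p = (LEAST l. l < length xs \<longrightarrow> ?f l \<le> v)"
  have v: "b = v + h" "v \<notin> beta xs" using * by (auto simp: v_def)
  have mono: "xs ! m \<le> xs ! l" if "l \<le> m" "m < length xs" for l m
    using xs that by (cases "l = m") (auto simp: is_partition_def sorted_wrt_iff_nth_less)
  have pos: "0 < xs ! l" if "l < length xs" for l
    using xs that by (auto simp: is_partition_def)
  have "p \<le> length xs" unfolding p_def by (rule Least_le) simp
  have "p < length xs \<longrightarrow> ?f p \<le> v" unfolding p_def by (rule LeastI[of _ "length xs"]) simp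
  moreover have "p < length xs \<longrightarrow> ?f p \<noteq> v" using v(2) unfolding beta_eq_nth by blast
  ultimately have fp: "?f p < v" if "p < length xs" using that by linarith
  have less_p: "v < ?f l" if "l < p" for l
    using not_less_Least[OF that[unfolded p_def]] by simp
  have "k < p"
  proof (rule ccontr)
    assume "\<not> k < p"
    then show False using fp mono[of p k] k v(1) h unfolding b_def by linarith
  qed
  \<comment> \<open>This is the column whose gap is \<open>v\<close>; the subtraction is not
    truncated, as shown next.\<close>
  define j where "j = v - (length xs - p)"
  have "length xs - p \<le> v"
    using fp pos[of p] \<open>p \<le> length xs\<close> by (cases "p < length xs") auto
  then have vj: "v = j + (length xs - p)" by (simp add: j_def)
  have "j < xs ! l \<longleftrightarrow> l < p" if "l < length xs" for l
  proof
    assume "l < p"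
    then show "j < xs ! l"
      using less_p[of "p - 1"] mono[of l "p - 1"] vj \<open>p \<le> length xs\<close> by linarith
  next
    assume "j < xs ! l"
    show "l < p"
    proof (rule ccontr)
      assume "\<not> l < p"
      then show False using fp mono[of p l] vj that \<open>j < xs ! l\<close> by linarith
    qed
  qed
  then have iff: "l < conj_part xs j \<longleftrightarrow> l < p" if "l < length xs" for l
    using conj_part_less[OF xs that, of j] that by blast
  have "conj_part xs j = p"
    using iff[of p] iff[of "conj_part xs j"] conj_part_le[of xs j] \<open>p \<le> length xs\<close> by linarith
  moreover have "j < xs ! k"
    using conj_part_less[OF xs k, of j] \<open>k < p\<close> \<open>conj_part xs j = p\<close> by simp
  ultimately have "hook_length xs k j = h"
    using v(1) vj \<open>k < p\<close> \<open>p \<le> length xs\<close> unfolding hook_length_def b_def by linarith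
  then show "\<exists>j < xs ! k. hook_length xs k j = h"
    using \<open>j < xs ! k\<close> by blast
qed

text \<open>By \<open>hook_length_iff\<close>, avoiding all multiples of \<open>t\<close> as hook
  lengths means that subtracting any multiple of \<open>t\<close> that fits stays in the beta set;
  iterating the single step \<open>t\<close> suffices.\<close>

lemma is_core_iff_beta:
  assumes "is_partition xs" "0 < t"
  shows "is_core t xs \<longleftrightarrow> (\<forall>b\<in>beta xs. t \<le> b \<longrightarrow> b - t \<in> beta xs)"
proof -
  have "is_core t xs \<longleftrightarrow>
      (\<forall>k<length xs. \<forall>h>0. t dvd h \<longrightarrow> \<not> (\<exists>j < xs ! k. hook_length xs k j = h))"
  proof -
    have "0 < hook_length xs k j" for k j by (simp add: hook_length_def)
    then show ?thesis unfolding is_core_def by blast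
  qed
  also have "\<dots> \<longleftrightarrow> (\<forall>b\<in>beta xs. \<forall>h>0. t dvd h \<longrightarrow> h \<le> b \<longrightarrow> b - h \<in> beta xs)"
  proof -
    have "(\<forall>b\<in>beta xs. P b) \<longleftrightarrow> (\<forall>k<length xs. P (xs ! k + (length xs - k - 1)))" for P
      unfolding beta_eq_nth by blast
    moreover have "(\<forall>h>0. t dvd h \<longrightarrow> \<not> (\<exists>j < xs ! k. hook_length xs k j = h)) \<longleftrightarrow>
        (\<forall>h>0. t dvd h \<longrightarrow> h \<le> xs ! k + (length xs - k - 1) \<longrightarrow> xs ! k + (length xs - k - 1) - h \<in> beta xs)"
      if "k < length xs" for k
    proof -
      have "\<not> (\<exists>j < xs ! k. hook_length xs k j = h) \<longleftrightarrow>
          (h \<le> xs ! k + (length xs - k - 1) \<longrightarrow> xs ! k + (length xs - k - 1) - h \<in> beta xs)"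
        if "0 < h" for h
        unfolding hook_length_iff[OF assms(1) \<open>k < length xs\<close> that] by blast
      then show ?thesis by (simp cong: imp_cong)
    qed
    ultimately show ?thesis by simp
  qed
  also have "\<dots> \<longleftrightarrow> (\<forall>b\<in>beta xs. t \<le> b \<longrightarrow> b - t \<in> beta xs)"
  proof (intro iffI ballI allI impI)
    fix b h
    assume *: "\<forall>b\<in>beta xs. t \<le> b \<longrightarrow> b - t \<in> beta xs" and b: "b \<in> beta xs" "t dvd h" "h \<le> b"
    then obtain c where "h = t * c" by blast
    have "t * c \<le> b \<Longrightarrow> b - t * c \<in> beta xs" for c
    proof (induction c)
      case (Suc c)
      then have "b - t * c \<in> beta xs" "t \<le> b - t * c" by simp_all
      then have "b - t * c - t \<in> beta xs" using * by blast
      then show ?case by (simp add: algebra_simps)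
    qed (use b in simp)
    then show "b - h \<in> beta xs" using b \<open>h = t * c\<close> by blast
  qed (use assms(2) in auto)
  finally show ?thesis .
qed

section \<open>The abacus of a 3-core\<close>

text \<open>Flush beads on a three-runner abacus: \<open>i\<close> on the runner of residue 1 and
  \<open>j\<close> on that of residue 2. The runner of residue 0 is empty because beta sets omit
  0.\<close>

definition abacus :: "nat \<Rightarrow> nat \<Rightarrow> nat set" where
  "abacus i j = (\<lambda>t. 3 * t + 1) ` {..<i} \<union> (\<lambda>t. 3 * t + 2) ` {..<j}"

lemma finite_abacus: "finite (abacus i j)"
  by (simp add: abacus_def)

lemma abacus_iff: "b \<in> abacus i j \<longleftrightarrow> b mod 3 = 1 \<and> b < 3 * i \<or> b mod 3 = 2 \<and> b < 3 * j"
proof -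
  have "b \<in> (\<lambda>t. 3 * t + r) ` {..<n} \<longleftrightarrow> b mod 3 = r \<and> b < 3 * n" if "r < 3" for r n
  proof
    assume "b mod 3 = r \<and> b < 3 * n"
    then show "b \<in> (\<lambda>t. 3 * t + r) ` {..<n}"
      using mult_div_mod_eq[of 3 b] by (intro image_eqI[of _ _ "b div 3"]) auto
  qed (use that in auto)
  from this[of 1 i] this[of 2 j] show ?thesis by (simp add: abacus_def)
qed

lemma abacus_disjoint: "(\<lambda>t. 3 * t + 1) ` {..<i::nat} \<inter> (\<lambda>t. 3 * t + 2) ` {..<j} = {}"
proof -
  have "3 * s + 1 \<noteq> 3 * t + (2::nat)" for s t by presburger
  then show ?thesis by blast
qed

lemma card_abacus: "card (abacus i j) = i + j"
  unfolding abacus_def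
  by (subst card_Un_disjoint[OF _ _ abacus_disjoint]) (simp_all add: card_image inj_on_def)

lemma sum_lessThan_id: "2 * int (\<Sum>{..<n}) = int n * (int n - 1)"
  by (induction n) (auto simp: algebra_simps)

lemma sum_abacus: "2 * int (\<Sum>(abacus i j)) = 3 * (int i)\<^sup>2 - int i + 3 * (int j)\<^sup>2 + int j"
proof -
  have "\<Sum>(abacus i j) = (\<Sum>t<i. 3 * t + 1) + (\<Sum>t<j. 3 * t + 2)"
    unfolding abacus_def
    by (subst sum.union_disjoint[OF _ _ abacus_disjoint]) (simp_all add: sum.reindex inj_on_def)
  moreover have "2 * int (\<Sum>t<i. 3 * t + 1) = 3 * (int i)\<^sup>2 - int i"
    by (induction i) (auto simp: algebra_simps power2_eq_square)
  moreover have "2 * int (\<Sum>t<j. 3 * t + 2) = 3 * (int j)\<^sup>2 + int j"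
    by (induction j) (auto simp: algebra_simps power2_eq_square)
  ultimately show ?thesis by simp
qed

lemma abacus_inj: "abacus i j = abacus i' j' \<Longrightarrow> i = i' \<and> j = j'"
proof -
  assume eq: "abacus i j = abacus i' j'"
  have r: "(3 * t + 1) mod 3 = (1::nat)" "(3 * t + 2) mod 3 = (2::nat)" for t
    by presburger+
  have iff: "(3 * t + 1 \<in> abacus i j) = (t < i)" "(3 * t + 2 \<in> abacus i j) = (t < j)" for t i j
    unfolding abacus_iff r by auto
  then have lt: "t < i \<longleftrightarrow> t < i'" "t < j \<longleftrightarrow> t < j'" for t
    using iff[of t i j] iff[of t i' j'] unfolding eq by simp_all
  have "{..<i} = {..<i'}" "{..<j} = {..<j'}"
    unfolding lessThan_def lt by (rule refl)+
  then show ?thesis by simp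
qed

lemma downward_closed_finite:
  assumes "finite S" "\<And>t. Suc t \<in> S \<Longrightarrow> t \<in> S"
  shows "\<exists>n. S = {..<n}"
proof -
  have le: "s \<in> S" if "s \<le> t" "t \<in> S" for s t
    using that
  proof (induction t rule: dec_induct)
    case (step t)
    then show ?case using assms(2) by blast
  qed
  define n where "n = (LEAST t. t \<notin> S)"
  have "n \<notin> S" unfolding n_def
    using ex_new_if_finite[OF infinite_UNIV_nat assms(1)] by (rule LeastI_ex)
  moreover have "t \<in> S" if "t < n" for t
    using not_less_Least that unfolding n_def by blast
  ultimately have "t \<in> S \<longleftrightarrow> t < n" for t using le[of n t] by (cases "t < n") auto
  then have "S = {..<n}" by blast
  then show ?thesis ..
qed

text \<open>Closure under subtracting 3 makes the beta set an initial segment of every residue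
  class, and \<open>beta_pos\<close> empties the class of 0.\<close>

lemma is_core_3_iff_abacus:
  assumes "is_partition xs"
  shows "is_core 3 xs \<longleftrightarrow> (\<exists>i j. beta xs = abacus i j)"
proof
  assume "is_core 3 xs"
  then have closed: "b - 3 \<in> beta xs" if "b \<in> beta xs" "3 \<le> b" for b
    using that is_core_iff_beta[OF assms] by simp
  have "\<exists>n. {t. 3 * t + r \<in> beta xs} = {..<n}" for r
  proof (rule downward_closed_finite)
    show "finite {t. 3 * t + r \<in> beta xs}"
      using finite_vimageI[OF finite_beta, of "\<lambda>t. 3 * t + r" xs] by (simp add: inj_def vimage_def)
  qed (use closed in fastforce)
  then have "\<exists>n. \<forall>r. {t. 3 * t + r \<in> beta xs} = {..<n r}"
    by (intro choice allI)
  then obtain n where "\<forall>r. {t. 3 * t + r \<in> beta xs} = {..<n r}" ..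
  then have n: "3 * t + r \<in> beta xs \<longleftrightarrow> t < n r" for t r
    by (simp add: set_eq_iff)
  have "n 0 = 0"
    using n[of 0 0] beta_pos[OF assms, of 0] by auto
  have "beta xs = abacus (n 1) (n 2)"
  proof (rule Set.set_eqI)
    fix b
    have "b \<in> beta xs \<longleftrightarrow> b div 3 < n (b mod 3)"
      using n[of "b div 3" "b mod 3"] by simp
    moreover have "b mod 3 = 0 \<or> b mod 3 = 1 \<or> b mod 3 = 2" by presburger
    ultimately show "b \<in> beta xs \<longleftrightarrow> b \<in> abacus (n 1) (n 2)"
      unfolding abacus_iff using \<open>n 0 = 0\<close> by (elim disjE) (auto simp: div_less_iff_less_mult)
  qed
  then show "\<exists>i j. beta xs = abacus i j" by blast
next
  assume "\<exists>i j. beta xs = abacus i j"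
  moreover have "(b - 3) mod 3 = b mod 3" if "3 \<le> b" for b :: nat
    using le_mod_geq[OF that] by simp
  ultimately show "is_core 3 xs"
    unfolding is_core_iff_beta[OF assms zero_less_numeral] by (auto simp: abacus_iff)
qed

definition cores3 :: "nat \<Rightarrow> nat list set" where
  "cores3 m = {xs. is_partition xs \<and> is_core 3 xs \<and> sum_list xs = m}"

text \<open>By \<open>sum_beta\<close>, the size is the sum of the abacus minus the sum of all
  numbers below i + j.\<close>

lemma sum_list_core3:
  assumes "is_partition xs" "beta xs = abacus i j"
  shows "int (sum_list xs) = (int i)\<^sup>2 - int i * int j + (int j)\<^sup>2 + int j"
proof -
  have "length xs = i + j" using card_beta[OF assms(1)] by (simp add: assms(2) card_abacus)
  then have "int (\<Sum>(abacus i j)) = int (sum_list xs) + int (\<Sum>{..<i + j})"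
    using sum_beta[OF assms(1)] assms(2) by (simp del: of_nat_sum)
  then have "2 * int (\<Sum>(abacus i j)) = 2 * int (sum_list xs) + 2 * int (\<Sum>{..<i + j})"
    by linarith
  then have "2 * int (sum_list xs) = 2 * ((int i)\<^sup>2 - int i * int j + (int j)\<^sup>2 + int j)"
    unfolding sum_abacus sum_lessThan_id by (simp add: algebra_simps power2_eq_square)
  then show ?thesis by simp
qed

lemma bij_cores3:
  "\<exists>f. bij_betw f (cores3 m) {(i::nat, j::nat). (int i)\<^sup>2 - int i * int j + (int j)\<^sup>2 + int j = int m}"
proof -
  have "\<exists>i j. beta xs = abacus i j" if "xs \<in> cores3 m" for xs
    using that is_core_3_iff_abacus by (auto simp: cores3_def)
  then obtain f g where fg: "beta xs = abacus (f xs) (g xs)" if "xs \<in> cores3 m" for xs by metis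
  have "bij_betw (\<lambda>xs. (f xs, g xs)) (cores3 m)
      {(i, j). (int i)\<^sup>2 - int i * int j + (int j)\<^sup>2 + int j = int m}"
    unfolding bij_betw_def
  proof (intro conjI equalityI subsetI)
    show "inj_on (\<lambda>xs. (f xs, g xs)) (cores3 m)"
      using fg beta_inj unfolding inj_on_def cores3_def by (auto; metis)
  next
    fix p assume "p \<in> (\<lambda>xs. (f xs, g xs)) ` cores3 m"
    then show "p \<in> {(i, j). (int i)\<^sup>2 - int i * int j + (int j)\<^sup>2 + int j = int m}"
      using fg sum_list_core3 by (fastforce simp: cores3_def)
  next
    fix p assume p: "p \<in> {(i, j). (int i)\<^sup>2 - int i * int j + (int j)\<^sup>2 + int j = int m}"
    obtain i j where ij: "p = (i, j)" by (cases p)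
    have "0 \<notin> abacus i j" by (simp add: abacus_iff)
    then obtain xs where xs: "is_partition xs" "beta xs = abacus i j"
      using beta_surj[OF finite_abacus] by blast
    then have "xs \<in> cores3 m"
      using p ij sum_list_core3[OF xs] is_core_3_iff_abacus[OF xs(1)] by (auto simp: cores3_def)
    moreover have "f xs = i" "g xs = j"
      using fg[OF calculation] xs(2) abacus_inj by metis+
    ultimately show "p \<in> (\<lambda>xs. (f xs, g xs)) ` cores3 m" using ij by force
  qed
  then show ?thesis by blast
qed

section \<open>Eisenstein integers of given norm\<close>

text \<open>The pair \<open>(x, y)\<close> stands for \<open>x + y\<omega>\<close> with \<open>\<omega>\<^sup>2 + \<omega> + 1 = 0\<close>.\<close>
fun eis_norm :: "int \<times> int \<Rightarrow> int" where
  "eis_norm (x, y) = x\<^sup>2 - x * y + y\<^sup>2"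

fun eis_mult :: "int \<times> int \<Rightarrow> int \<times> int \<Rightarrow> int \<times> int" where
  "eis_mult (x, y) (a, b) = (x * a - y * b, x * b + y * a - y * b)"

text \<open>The conjugate of \<omega> is its square, which equals - 1 - \<omega>.\<close>

fun eis_conj :: "int \<times> int \<Rightarrow> int \<times> int" where
  "eis_conj (x, y) = (x - y, - y)"

lemma eis_norm_mult: "eis_norm (eis_mult z w) = eis_norm z * eis_norm w"
  by (cases z; cases w) (simp add: power2_eq_square algebra_simps)

lemma eis_norm_conj: "eis_norm (eis_conj z) = eis_norm z"
  by (cases z) (simp add: power2_eq_square algebra_simps)

lemma eis_mult_commute: "eis_mult z w = eis_mult w z"
  by (cases z; cases w) (simp add: algebra_simps)

lemma eis_mult_assoc: "eis_mult (eis_mult u v) w = eis_mult u (eis_mult v w)"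
  by (cases u; cases v; cases w) (simp add: algebra_simps)

lemma eis_mult_conj: "eis_mult z (eis_conj z) = (eis_norm z, 0)"
  by (cases z) (simp add: power2_eq_square algebra_simps)

lemma eis_conj_conj: "eis_conj (eis_conj z) = z"
  by (cases z) simp

text \<open>A sum of squares, from which definiteness and the bounds on coordinates follow.\<close>

lemma double_eis_norm: "2 * eis_norm (x, y) = x\<^sup>2 + y\<^sup>2 + (x - y)\<^sup>2"
  by (simp add: power2_eq_square algebra_simps)

lemma eis_norm_eq_0_iff: "eis_norm z = 0 \<longleftrightarrow> z = (0, 0)"
proof
  assume "eis_norm z = 0"
  moreover obtain x y where "z = (x, y)" by (cases z)
  ultimately have "x\<^sup>2 + y\<^sup>2 + (x - y)\<^sup>2 = 0" using double_eis_norm[of x y] by simp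
  then have "x\<^sup>2 = 0" "y\<^sup>2 = 0"
    using zero_le_power2[of x] zero_le_power2[of y] zero_le_power2[of "x - y"] by linarith+
  then show "z = (0, 0)" using \<open>z = (x, y)\<close> by simp
qed simp

text \<open>Multiplying by the conjugate of \<open>c\<close> reduces the claim to cancelling the
  nonzero integer \<open>eis_norm c\<close>.\<close>

lemma eis_mult_cancel:
  assumes "eis_mult c z = eis_mult c w" "eis_norm c \<noteq> 0"
  shows "z = w"
proof -
  have "eis_mult (eis_norm c, 0) z = eis_mult (eis_norm c, 0) w"
    using arg_cong[OF assms(1), of "eis_mult (eis_conj c)"]
    by (simp flip: eis_mult_assoc eis_mult_conj add: eis_mult_commute[of c "eis_conj c"])
  then show ?thesis using assms(2) by (cases z; cases w) simp
qed

definition eis_shell :: "nat \<Rightarrow> (int \<times> int) set" where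
  "eis_shell n = {z. eis_norm z = int n}"

lemma eis_shell_bound:
  assumes "(x, y) \<in> eis_shell n"
  shows "x\<^sup>2 + y\<^sup>2 \<le> 2 * int n"
  using assms double_eis_norm[of x y] zero_le_power2[of "x - y"] unfolding eis_shell_def by simp

lemma finite_eis_shell: "finite (eis_shell n)"
proof (rule finite_subset)
  show "eis_shell n \<subseteq> {- 2 * int n..2 * int n} \<times> {- 2 * int n..2 * int n}"
  proof clarify
    fix x y assume "(x, y) \<in> eis_shell n"
    then have "x\<^sup>2 \<le> 2 * int n" "y\<^sup>2 \<le> 2 * int n"
      using eis_shell_bound[of x y n] zero_le_power2[of x] zero_le_power2[of y] by linarith+
    moreover have "\<bar>t\<bar> \<le> t\<^sup>2" for t :: int
      using self_le_power[of "\<bar>t\<bar>" 2] by (cases "t = 0") auto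
    from this[of x] this[of y]
    show "x \<in> {- 2 * int n..2 * int n} \<and> y \<in> {- 2 * int n..2 * int n}"
      using calculation by auto
  qed
qed simp

lemma card_eis_shell_1: "card (eis_shell 1) = 6"
proof -
  \<comment> \<open>The six units: 1, \<omega>, 1 + \<omega> and their negatives.\<close>
  have "eis_shell 1 = {(1, 0), (-1, 0), (0, 1), (0, -1), (1, 1), (-1, -1)}"
  proof (intro equalityI subsetI)
    fix z assume z: "z \<in> eis_shell 1"
    obtain x y where xy: "z = (x, y)" by (cases z)
    have *: "- 1 \<le> s \<and> s \<le> 1" if "s\<^sup>2 + t\<^sup>2 \<le> 2" for s t :: int
    proof -
      have "s\<^sup>2 < 4" using that zero_le_power2[of t] by linarith
      then have "\<bar>s\<bar>\<^sup>2 < 2\<^sup>2" by simp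
      then have "\<bar>s\<bar> < 2" by (rule power2_less_imp_less) simp
      then show ?thesis by linarith
    qed
    have b: "x\<^sup>2 + y\<^sup>2 \<le> 2" using eis_shell_bound[of x y 1] z xy by simp
    then have "x = -1 \<or> x = 0 \<or> x = 1" "y = -1 \<or> y = 0 \<or> y = 1"
      using *[of x y] *[of y x] by linarith+
    then show "z \<in> {(1, 0), (-1, 0), (0, 1), (0, -1), (1, 1), (-1, -1)}"
      using z xy by (elim disjE) (auto simp: eis_shell_def)
  qed (auto simp: eis_shell_def)
  then show ?thesis by simp
qed

definition eis_dvd_shell :: "nat \<Rightarrow> nat \<Rightarrow> (int \<times> int) set" where
  "eis_dvd_shell p n = {(x, y) \<in> eis_shell n. int p dvd x \<and> int p dvd y}"

text \<open>Removing the integer factor \<open>p\<close> divides the norm by p^2, so p m becomes m /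
  p.\<close>

lemma eis_dvd_shell_eq:
  assumes "p > 0"
  shows "eis_dvd_shell p (p * m) = (if p dvd m then eis_mult (int p, 0) ` eis_shell (m div p) else {})"
proof -
  have *: "p dvd m \<and> w \<in> eis_shell (m div p)"
    if w: "eis_norm (eis_mult (int p, 0) w) = int (p * m)" for w
  proof -
    have "int p * int p * eis_norm w = int p * int m"
      using w by (simp add: eis_norm_mult power2_eq_square)
    then have m: "int m = int p * eis_norm w" using assms by simp
    then have "p dvd m" by (metis dvd_triv_left int_dvd_int_iff)
    moreover have "eis_norm w = int (m div p)"
      using m assms by (simp add: zdiv_int)
    ultimately show ?thesis by (simp add: eis_shell_def)
  qed
  show ?thesis
  proof (intro equalityI subsetI)
    fix z assume "z \<in> eis_dvd_shell p (p * m)"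
    then obtain x y where z: "z = (int p * x, int p * y)" "z \<in> eis_shell (p * m)"
      by (auto simp: eis_dvd_shell_def dvd_def)
    then have z': "z = eis_mult (int p, 0) (x, y)" by simp
    then show "z \<in> (if p dvd m then eis_mult (int p, 0) ` eis_shell (m div p) else {})"
      using *[of "(x, y)"] z(2) unfolding eis_shell_def by (auto simp del: eis_mult.simps eis_norm.simps)
  next
    fix z assume "z \<in> (if p dvd m then eis_mult (int p, 0) ` eis_shell (m div p) else {})"
    then obtain w where w: "p dvd m" "w \<in> eis_shell (m div p)" "z = eis_mult (int p, 0) w"
      by (auto split: if_splits simp del: eis_mult.simps)
    then have "eis_norm z = int p * int p * int (m div p)"
      by (simp add: eis_norm_mult eis_shell_def power2_eq_square)
    also have "\<dots> = int (p * m)" using w(1) by (elim dvdE) (use assms in simp)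
    finally show "z \<in> eis_dvd_shell p (p * m)"
      using w(3) by (cases w) (auto simp: eis_dvd_shell_def eis_shell_def simp del: eis_norm.simps)
  qed
qed

lemma card_eis_mult_image:
  assumes "eis_norm c \<noteq> 0"
  shows "card (eis_mult c ` S) = card S"
  using assms eis_mult_cancel by (intro card_image inj_onI) blast

lemma card_eis_dvd_shell:
  assumes "p > 0"
  shows "card (eis_dvd_shell p (p * m)) = (if p dvd m then card (eis_shell (m div p)) else 0)"
  unfolding eis_dvd_shell_eq[OF assms] using assms by (simp add: card_eis_mult_image)

section \<open>Inert primes\<close>

lemma fermat_theorem_int:
  fixes x :: int
  assumes "prime p" "\<not> int p dvd x"
  shows "[x ^ (p - 1) = 1] (mod int p)"
proof -
  define a where "a = nat (x mod int p)"
  have a: "int a = x mod int p" using prime_gt_0_nat[OF assms(1)] by (simp add: a_def)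
  then have "\<not> int p dvd int a" using assms(2) by (simp add: dvd_mod_iff)
  then have "[a ^ (p - 1) = 1] (mod p)"
    using assms(1) by (intro fermat_theorem) auto
  then have "[int a ^ (p - 1) = 1] (mod int p)"
    by (metis cong_int_iff of_nat_1 of_nat_power)
  moreover have "[x ^ (p - 1) = int a ^ (p - 1)] (mod int p)"
    unfolding a by (intro cong_pow) (simp add: cong_def)
  ultimately show ?thesis by (rule cong_trans[rotated])
qed

lemma prime_int_dvd_3:
  assumes "prime p" "int p dvd 3"
  shows "p = 3"
proof -
  have "p dvd 3" using assms(2) int_dvd_int_iff[of p 3] by simp
  then show ?thesis using assms(1) primes_dvd_imp_eq[of p 3] by simp
qed

lemma prime_int_dvd_4:
  assumes "prime p" "int p dvd 4"
  shows "p = 2"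
proof -
  have "p dvd 2 * 2" using assms(2) int_dvd_int_iff[of p 4] by simp
  then have "p dvd 2" using assms(1) prime_dvd_mult_iff by blast
  then show ?thesis using assms(1) primes_dvd_imp_eq[of p 2] by simp
qed

text \<open>If \<open>p\<close> divided neither coordinate, x^3 = - y^3 modulo \<open>p\<close> and
  Fermat's theorem with p - 1 = 3k + 1 would give x^2 = y^2 modulo \<open>p\<close>. The norm then
  forces \<open>p\<close> to divide 2x - y, hence 3x^2, which is impossible.\<close>

lemma inert_prime_dvd:
  assumes p: "prime p" "p mod 3 = 2" and dvd: "int p dvd eis_norm (x, y)"
  shows "int p dvd x \<and> int p dvd y"
proof (rule ccontr)
  assume not: "\<not> (int p dvd x \<and> int p dvd y)"
  have ip: "prime (int p)" using p(1) by simp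
  have "int p dvd x \<longleftrightarrow> int p dvd y"
  proof -
    have "int p dvd t" if "int p dvd s" "int p dvd eis_norm (s, t) \<or> int p dvd eis_norm (t, s)" for s t
    proof -
      have "t\<^sup>2 = eis_norm (s, t) - s * (s - t)" "eis_norm (s, t) = eis_norm (t, s)"
        by (simp_all add: power2_eq_square algebra_simps)
      then have "int p dvd t\<^sup>2" using that by (metis dvd_diff dvd_mult2)
      then show ?thesis using ip prime_dvd_power by blast
    qed
    then show ?thesis using dvd by blast
  qed
  then have nx: "\<not> int p dvd x" and ny: "\<not> int p dvd y" using not by auto
  define k where "k = p div 3"
  have k: "p - 1 = 3 * k + 1" using p(2) unfolding k_def by presburger
  \<comment> \<open>By Fermat's theorem these are the inverses of \<open>x\<close> and
    \<open>y\<close> modulo \<open>p\<close>.\<close>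
  define u v where "u = x ^ (3 * k)" and "v = y ^ (3 * k)"
  have ux: "[u * x = 1] (mod int p)" and vy: "[v * y = 1] (mod int p)"
    using fermat_theorem_int[OF p(1) nx] fermat_theorem_int[OF p(1) ny]
    unfolding k by (simp_all add: u_def v_def mult.commute)
  have "[x ^ 3 = - (y ^ 3)] (mod int p)"
  proof -
    have "x ^ 3 - - (y ^ 3) = (x + y) * eis_norm (x, y)"
      by (simp add: power2_eq_square power3_eq_cube algebra_simps)
    then show ?thesis using dvd by (simp add: cong_iff_dvd_diff del: eis_norm.simps)
  qed
  \<comment> \<open>Squaring removes the sign of the k-th power of - y^3.\<close>
  then have "[((x ^ 3) ^ k)\<^sup>2 = ((- (y ^ 3)) ^ k)\<^sup>2] (mod int p)"
    by (intro cong_pow)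
  moreover have "((- (y ^ 3)) ^ k)\<^sup>2 = v\<^sup>2"
    unfolding v_def power_mult by (simp flip: power_mult power_mult_distrib add: mult.commute[of k] power_mult[of _ 2] power2_minus)
  ultimately have uv: "[u\<^sup>2 = v\<^sup>2] (mod int p)"
    by (simp add: u_def power_mult)
  have "[y\<^sup>2 = (u * x)\<^sup>2 * y\<^sup>2] (mod int p)"
    using cong_mult[OF cong_pow[OF ux, of 2] cong_refl[of "y\<^sup>2"]] by (simp add: cong_sym_eq)
  also have "[(u * x)\<^sup>2 * y\<^sup>2 = v\<^sup>2 * (x\<^sup>2 * y\<^sup>2)] (mod int p)"
    using cong_mult[OF uv cong_refl[of "x\<^sup>2 * y\<^sup>2"]] by (simp add: power_mult_distrib mult.assoc)
  also have "v\<^sup>2 * (x\<^sup>2 * y\<^sup>2) = (v * y)\<^sup>2 * x\<^sup>2"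
    by (simp add: power_mult_distrib)
  also have "[(v * y)\<^sup>2 * x\<^sup>2 = x\<^sup>2] (mod int p)"
    using cong_mult[OF cong_pow[OF vy, of 2] cong_refl[of "x\<^sup>2"]] by simp
  finally have yx: "int p dvd y\<^sup>2 - x\<^sup>2" by (simp add: cong_iff_dvd_diff)
  have "x * (2 * x - y) = eis_norm (x, y) - (y\<^sup>2 - x\<^sup>2)"
    by (simp add: power2_eq_square algebra_simps)
  then have "int p dvd x * (2 * x - y)" using dvd yx by (simp del: eis_norm.simps)
  then have "int p dvd 2 * x - y" using ip nx prime_dvd_mult_iff by blast
  moreover have "3 * x\<^sup>2 = (2 * x - y) * (2 * x + y) + (y\<^sup>2 - x\<^sup>2)"
    by (simp add: power2_eq_square algebra_simps)
  ultimately have "int p dvd 3 * x\<^sup>2" using yx by (simp only: dvd_add dvd_mult2)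
  then have "int p dvd 3" using ip nx prime_dvd_mult_iff prime_dvd_power by blast
  then have "p = 3" by (rule prime_int_dvd_3[OF p(1)])
  then show False using p(2) by simp
qed

lemma card_eis_shell_inert:
  assumes "prime p" "p mod 3 = 2"
  shows "card (eis_shell (p * m)) = (if p dvd m then card (eis_shell (m div p)) else 0)"
proof -
  have "int p dvd x \<and> int p dvd y" if "(x, y) \<in> eis_shell (p * m)" for x y
    using that by (intro inert_prime_dvd[OF assms]) (simp add: eis_shell_def del: eis_norm.simps)
  then have "eis_shell (p * m) = eis_dvd_shell p (p * m)"
    unfolding eis_dvd_shell_def by blast
  then show ?thesis using card_eis_dvd_shell prime_gt_0_nat[OF assms(1)] by simp
qed

section \<open>Split primes\<close>

text \<open>An integer \<open>z\<close> is a multiple of \<open>c\<close> once \<open>p\<close>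
  divides z times the conjugate of \<open>c\<close>. One coordinate suffices: the norm of that
  product is a multiple of p^2, so the other coordinate is divisible too.\<close>

lemma split_prime_image:
  assumes p: "prime p" and c: "eis_norm c = int p"
    and z: "z \<in> eis_shell (p * m)" and dvd: "int p dvd snd (eis_mult z (eis_conj c))"
  shows "z \<in> eis_mult c ` eis_shell m"
proof -
  have p0: "int p > 0" using prime_gt_0_nat[OF p] by simp
  obtain u v where uv: "eis_mult z (eis_conj c) = (u, v)" by (cases "eis_mult z (eis_conj c)")
  have "eis_norm (u, v) = int p * (int p * int m)"
    using z c unfolding uv[symmetric] eis_norm_mult eis_norm_conj by (simp add: eis_shell_def)
  moreover have "u\<^sup>2 = eis_norm (u, v) - v * (v - u)" by (simp add: power2_eq_square algebra_simps)
  ultimately have "int p dvd u\<^sup>2" using dvd uv by (simp del: eis_norm.simps)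
  then have "int p dvd u" using p prime_dvd_power[of "int p"] by simp
  then obtain s t where "u = int p * s" "v = int p * t" using dvd uv by (auto elim!: dvdE)
  then have st: "eis_mult z (eis_conj c) = eis_mult (int p, 0) (s, t)" using uv by simp
  have "eis_mult (int p, 0) z = eis_mult (eis_mult z (eis_conj c)) c"
    unfolding eis_mult_assoc eis_mult_commute[of "eis_conj c"] eis_mult_conj c
    by (rule eis_mult_commute)
  also have "\<dots> = eis_mult (int p, 0) (eis_mult c (s, t))"
    unfolding st eis_mult_assoc by (simp only: eis_mult_commute)
  finally have zc: "z = eis_mult c (s, t)" by (rule eis_mult_cancel) (use p0 in simp)
  have "int p * eis_norm (s, t) = int p * int m"
    using z unfolding zc eis_shell_def mem_Collect_eq eis_norm_mult c by simp
  then have "(s, t) \<in> eis_shell m" using p0 unfolding eis_shell_def by simp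
  then show ?thesis using zc by blast
qed

text \<open>Inclusion and exclusion: the shell is the union of the multiples of \<open>c\<close> and
  of its conjugate, and their intersection consists of the multiples of \<open>p\<close>.\<close>

lemma card_eis_shell_split:
  assumes p: "prime p" "p \<noteq> 3" and c: "eis_norm c = int p"
  shows "card (eis_shell (p * m)) + (if p dvd m then card (eis_shell (m div p)) else 0)
    = 2 * card (eis_shell m)"
proof -
  obtain a b where ab: "c = (a, b)" by (cases c)
  have ip: "prime (int p)" and p0: "p > 0" using p prime_gt_0_nat by simp_all
  have c': "eis_norm (eis_conj c) = int p" using c by (simp add: eis_norm_conj)
  let ?A = "eis_mult c ` eis_shell m" and ?B = "eis_mult (eis_conj c) ` eis_shell m"
  have sub: "eis_mult d w \<in> eis_shell (p * m)" if "eis_norm d = int p" "w \<in> eis_shell m" for d w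
    using that by (simp add: eis_shell_def eis_norm_mult)
  have "eis_shell (p * m) \<subseteq> ?A \<union> ?B"
  proof
    fix z assume z: "z \<in> eis_shell (p * m)"
    obtain x y where xy: "z = (x, y)" by (cases z)
    \<comment> \<open>The product of the two second coordinates is a combination of norms divisible
      by \<open>p\<close>, so one factor is divisible by \<open>p\<close>.\<close>
    have "snd (eis_mult z (eis_conj c)) * snd (eis_mult z c) = y\<^sup>2 * eis_norm c - b\<^sup>2 * eis_norm z"
      unfolding xy ab by (simp add: power2_eq_square algebra_simps)
    also have "int p dvd \<dots>" using z c by (simp add: eis_shell_def)
    finally have "int p dvd snd (eis_mult z (eis_conj c)) \<or> int p dvd snd (eis_mult z c)"
      using ip prime_dvd_mult_iff by blast
    then show "z \<in> ?A \<union> ?B"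
      using split_prime_image[OF p(1) c z] split_prime_image[OF p(1) c' z] by (auto simp: eis_conj_conj)
  qed
  then have un: "eis_shell (p * m) = ?A \<union> ?B" using sub c c' by blast
  have int: "?A \<inter> ?B = eis_dvd_shell p (p * m)"
  proof (intro equalityI subsetI)
    fix z assume z: "z \<in> ?A \<inter> ?B"
    then obtain w w' where w: "z = eis_mult c w" "z = eis_mult (eis_conj c) w'" by blast
    obtain x y where xy: "z = (x, y)" by (cases z)
    obtain s t s' t' where st: "w = (s, t)" "w' = (s', t')" by (cases w; cases w')
    have "eis_mult (eis_conj c) z = eis_mult (int p, 0) w"
      unfolding w(1) using c by (simp flip: eis_mult_assoc add: eis_mult_commute[of "eis_conj c" c] eis_mult_conj del: eis_mult.simps)
    moreover have "eis_mult c z = eis_mult (int p, 0) w'"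
      unfolding w(2) using c by (simp flip: eis_mult_assoc add: eis_mult_conj del: eis_mult.simps)
    \<comment> \<open>Adding the two equations multiplies \<open>z\<close> by the trace 2a - b of
      \<open>c\<close>.\<close>
    ultimately have "(2 * a - b) * x = int p * (s + s')" "(2 * a - b) * y = int p * (t + t')"
      unfolding xy st ab by (simp_all add: algebra_simps)
    then have *: "int p dvd (2 * a - b) * x" "int p dvd (2 * a - b) * y" by simp_all
    \<comment> \<open>Otherwise (2a - b)^2 + 3b^2 = 4p makes \<open>p\<close> divide
      \<open>b\<close>, so p^2 divides 4p and p = 2. Then \<open>a\<close> and \<open>b\<close> are
      even and the norm 2 would be a multiple of 4.\<close>
    have "\<not> int p dvd 2 * a - b"
    proof
      assume d: "int p dvd 2 * a - b"
      then have dd: "int p * int p dvd (2 * a - b)\<^sup>2" by (auto simp: power2_eq_square intro: mult_dvd_mono)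
      have eq: "(2 * a - b)\<^sup>2 + 3 * b\<^sup>2 = 4 * int p"
        using c ab by (simp add: power2_eq_square algebra_simps)
      have "3 * b\<^sup>2 = 4 * int p - (2 * a - b)\<^sup>2" using eq by simp
      then have "int p dvd 3 * b\<^sup>2" using d by (simp add: power2_eq_square)
      moreover have "\<not> int p dvd 3"
        using p prime_int_dvd_3 by blast
      ultimately have "int p dvd b" using ip prime_dvd_mult_iff prime_dvd_power by blast
      then have "int p * int p dvd b\<^sup>2" by (auto simp: power2_eq_square intro: mult_dvd_mono)
      then have "int p * int p dvd 4 * int p" using dd eq by (metis dvd_add dvd_mult)
      then have "int p dvd 4" using p0 by simp
      then have "p = 2" by (rule prime_int_dvd_4[OF p(1)])
      then have "even b" using \<open>int p dvd b\<close> by simp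
      have "a\<^sup>2 = 2 + b * (a - b)" using c ab \<open>p = 2\<close> by (simp add: power2_eq_square algebra_simps)
      then have "even (a\<^sup>2)" using \<open>even b\<close> by simp
      then obtain a' b' where "a = 2 * a'" "b = 2 * b'" using \<open>even b\<close> by (auto elim!: evenE)
      then have "4 * (a'\<^sup>2 - a' * b' + b'\<^sup>2) = 2" using c ab \<open>p = 2\<close> by (simp add: power2_eq_square algebra_simps)
      then show False by presburger
    qed
    then have "int p dvd x" "int p dvd y" using * ip prime_dvd_mult_iff by blast+
    then show "z \<in> eis_dvd_shell p (p * m)" using z un xy by (auto simp: eis_dvd_shell_def)
  next
    fix z assume z: "z \<in> eis_dvd_shell p (p * m)"
    then obtain x y where xy: "z = (int p * x, int p * y)" and zm: "z \<in> eis_shell (p * m)"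
      by (auto simp: eis_dvd_shell_def dvd_def)
    have "int p dvd snd (eis_mult z d)" for d
      unfolding xy by (cases d) (simp add: algebra_simps)
    then show "z \<in> ?A \<inter> ?B"
      using split_prime_image[OF p(1) c zm] split_prime_image[OF p(1) c' zm] by blast
  qed
  have "card ?A + card ?B = card (?A \<union> ?B) + card (?A \<inter> ?B)"
    by (intro card_Un_Int finite_imageI finite_eis_shell)
  moreover have "card ?A = card (eis_shell m)" "card ?B = card (eis_shell m)"
    using c c' p0 by (simp_all add: card_eis_mult_image)
  ultimately show ?thesis using un int card_eis_dvd_shell[OF p0, of m] by simp
qed

text \<open>A primitive root raised to the power (p - 1)/3 is a root of t^3 - 1 different from 1
  modulo \<open>p\<close>.\<close>

lemma primitive_cube_root_mod_prime:
  assumes p: "prime p" "p mod 3 = 1"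
  obtains t :: int where "int p dvd t\<^sup>2 + t + 1"
proof -
  have p1: "p > 1" using p(1) prime_gt_1_nat by blast
  obtain g where g: "residue_primroot p g"
    using prime_primitive_root_exists[of p] p(1) p1 by auto
  define k where "k = (p - 1) div 3"
  have k: "p - 1 = 3 * k" "k > 0" using p(2) p1 unfolding k_def by presburger+
  have ord: "ord p g = 3 * k"
    using g p(1) k(1) by (simp add: residue_primroot_def totient_prime)
  define t where "t = int (g ^ k)"
  have "[g ^ (3 * k) = 1] (mod p)" unfolding ord_divides ord by simp
  then have "[int (g ^ (3 * k)) = int 1] (mod int p)" unfolding cong_int_iff .
  then have "int p dvd t ^ 3 - 1"
    unfolding cong_iff_dvd_diff by (simp add: t_def power_mult mult.commute[of 3])
  also have "t ^ 3 - 1 = (t - 1) * (t\<^sup>2 + t + 1)"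
    by (simp add: power2_eq_square power3_eq_cube algebra_simps)
  finally have "int p dvd (t - 1) * (t\<^sup>2 + t + 1)" .
  moreover have "\<not> int p dvd t - 1"
  proof
    assume "int p dvd t - 1"
    then have "[int (g ^ k) = int 1] (mod int p)" by (simp add: cong_iff_dvd_diff t_def)
    then have "[g ^ k = 1] (mod p)" unfolding cong_int_iff .
    then have "3 * k dvd k" unfolding ord_divides ord .
    then show False using k(2) by (auto dest: dvd_imp_le)
  qed
  moreover have "prime (int p)" using p(1) by simp
  ultimately have "int p dvd t\<^sup>2 + t + 1" using prime_dvd_mult_iff by blast
  then show ?thesis by (rule that)
qed

text \<open>Pigeonhole: the box has more than \<open>p\<close> points, so two share a value of x + t
  y modulo \<open>p\<close>; their difference is the solution. That \<open>p\<close> is not a square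
  makes the bounds strict.\<close>

lemma thue:
  assumes "p > 0" "\<And>s. s\<^sup>2 \<noteq> p"
  obtains x y :: int where "(x, y) \<noteq> (0, 0)" "x\<^sup>2 < int p" "y\<^sup>2 < int p" "int p dvd x + t * y"
proof -
  define r where "r = floor_sqrt p"
  have r: "r\<^sup>2 < p" "p < (Suc r)\<^sup>2"
    using assms(2)[of r] floor_sqrt_power2_le[of p] Suc_floor_sqrt_power2_gt[of p]
    unfolding r_def by linarith+
  define f where "f = (\<lambda>(x, y). (x + t * y) mod int p)"
  let ?D = "{0..int r} \<times> {0..int r}"
  have "f ` ?D \<subseteq> {0..<int p}" using assms(1) by (auto simp: f_def)
  then have "card (f ` ?D) \<le> p" using card_mono[of "{0..<int p}" "f ` ?D"] by simp
  also have "p < card ?D"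
    using r(2) by (simp add: card_cartesian_product power2_eq_square nat_add_distrib)
  finally have "\<not> inj_on f ?D" by (rule pigeonhole)
  then obtain x y x' y' where xy: "(x, y) \<in> ?D" "(x', y') \<in> ?D" "(x, y) \<noteq> (x', y')" "f (x, y) = f (x', y')"
    unfolding inj_on_def by (metis surj_pair)
  have sq: "(u - v)\<^sup>2 < int p" if "u \<in> {0..int r}" "v \<in> {0..int r}" for u v
  proof -
    have "\<bar>u - v\<bar> \<le> int r" using that by auto
    then have "(u - v)\<^sup>2 \<le> (int r)\<^sup>2" by (metis abs_of_nat abs_le_square_iff)
    also have "\<dots> < int p" using r(1) by (metis of_nat_less_iff of_nat_power)
    finally show ?thesis .
  qed
  have "int p dvd (x + t * y) - (x' + t * y')"
    using xy(4) by (simp add: f_def mod_eq_dvd_iff)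
  also have "(x + t * y) - (x' + t * y') = (x - x') + t * (y - y')"
    by (simp add: algebra_simps)
  finally show ?thesis using sq xy by (intro that[of "x - x'" "y - y'"]) auto
qed

text \<open>Thue's lemma for a cube root of unity \<open>t\<close> gives a nonzero element whose
  norm is a multiple of \<open>p\<close> below 3p; parity excludes 2p.\<close>

lemma split_prime_is_norm:
  assumes p: "prime p" "p mod 3 = 1"
  obtains c where "eis_norm c = int p"
proof -
  obtain t where t: "int p dvd t\<^sup>2 + t + 1" using primitive_cube_root_mod_prime[OF p] .
  have ns: "s\<^sup>2 \<noteq> p" for s :: nat
    using p(1) prime_product[of s s] by (auto simp: power2_eq_square)
  obtain x y where xy: "(x, y) \<noteq> (0, 0)" "x\<^sup>2 < int p" "y\<^sup>2 < int p" "int p dvd x + t * y"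
    using thue[OF prime_gt_0_nat[OF p(1)] ns] .
  \<comment> \<open>Modulo \<open>p\<close> the norm form factors over the roots - t and t +
    1.\<close>
  have "eis_norm (x, y) = (x + t * y) * (x - (t + 1) * y) + y\<^sup>2 * (t\<^sup>2 + t + 1)"
    by (simp add: power2_eq_square algebra_simps)
  then have "int p dvd eis_norm (x, y)" using xy(4) t by simp
  then obtain m where m: "eis_norm (x, y) = int p * m" by blast
  have "2 * eis_norm (x, y) = x\<^sup>2 + y\<^sup>2 + (x - y)\<^sup>2" by (rule double_eis_norm)
  moreover have "(x - y)\<^sup>2 + (x + y)\<^sup>2 = 2 * x\<^sup>2 + 2 * y\<^sup>2"
    by (simp add: power2_eq_square algebra_simps)
  ultimately have "eis_norm (x, y) < 3 * int p" "0 \<le> eis_norm (x, y)"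
    using xy(2,3) zero_le_power2[of "x + y"] zero_le_power2[of "x - y"] zero_le_power2[of x]
      zero_le_power2[of y] by linarith+
  moreover have "eis_norm (x, y) \<noteq> 0" using xy(1) eis_norm_eq_0_iff by blast
  ultimately have "0 < int p * m" "int p * m < int p * 3" using m by linarith+
  then have "0 < m" "m < 3" by (simp_all add: zero_less_mult_iff)
  \<comment> \<open>An even norm forces both coordinates to be even, so 4 divides 2p and p = 2,
    which is not 1 modulo 3.\<close>
  moreover have "m \<noteq> 2"
  proof
    assume "m = 2"
    then have e: "x\<^sup>2 - x * y + y\<^sup>2 = 2 * int p" using m by simp
    then have "even (x\<^sup>2 - x * y + y\<^sup>2)" by simp
    then have "even x" "even y" by auto
    then obtain x' y' where "x = 2 * x'" "y = 2 * y'" by (auto elim!: evenE)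
    then have "2 * (x'\<^sup>2 - x' * y' + y'\<^sup>2) = int p" using e
      by (simp add: power2_eq_square algebra_simps)
    then have "even p" by presburger
    then have "p = 2" using p(1) primes_dvd_imp_eq two_is_prime_nat by blast
    then show False using p(2) by simp
  qed
  ultimately have "m = 1" by linarith
  then show ?thesis using m that[of "(x, y)"] by (simp del: eis_norm.simps)
qed

section \<open>Comparison of the norm count with the character sum\<close>

text \<open>Divisors of p m are those of \<open>m\<close> together with \<open>p\<close> times those
  of \<open>m\<close>; the overlap is \<open>p\<close> times the divisors of m / p. For
  \<open>chi3 p\<close> equal to 1 and - 1 this is the split and the inert recurrence of the
  shells.\<close>

lemma chi3_sum_prime_mult:
  assumes p: "prime p" and m: "m > 0"
  shows "chi3_sum (p * m) + chi3 p * (if p dvd m then chi3_sum (m div p) else 0)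
    = (1 + chi3 p) * chi3_sum m"
proof -
  have p0: "p > 0" using p prime_gt_0_nat by blast
  let ?D = "{d. d dvd m}" and ?E = "(\<lambda>d. p * d) ` {d. d dvd m}"
  have "d dvd p * m \<longleftrightarrow> d \<in> ?D \<union> ?E" for d
  proof
    assume d: "d dvd p * m"
    show "d \<in> ?D \<union> ?E"
    proof (cases "p dvd d")
      case True
      then show ?thesis using d p0 by auto
    next
      case False
      then have "coprime d p" using p prime_imp_coprime coprime_commute by blast
      then show ?thesis using d coprime_dvd_mult_right_iff by blast
    qed
  qed auto
  then have un: "{d. d dvd p * m} = ?D \<union> ?E" by blast
  have int: "?D \<inter> ?E = (if p dvd m then (\<lambda>d. p * d) ` {d. d dvd m div p} else {})"
  proof (cases "p dvd m")
    case True
    then obtain l where "m = p * l" by blast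
    then show ?thesis using p0 by auto
  next
    case False
    then have "\<not> p * d dvd m" for d using dvd_mult_left by blast
    then show ?thesis using False by auto
  qed
  have sum_E: "sum chi3 ((\<lambda>d. p * d) ` {d. d dvd k}) = chi3 p * chi3_sum k" for k
    using p0 by (simp add: sum.reindex inj_on_def chi3_mult chi3_sum_def sum_distrib_left)
  have "chi3_sum (p * m) + sum chi3 (?D \<inter> ?E) = sum chi3 ?D + sum chi3 ?E"
    unfolding chi3_sum_def un using m by (intro sum.union_inter) auto
  moreover have "sum chi3 (?D \<inter> ?E) = chi3 p * (if p dvd m then chi3_sum (m div p) else 0)"
    unfolding int by (simp add: sum_E)
  moreover have "sum chi3 ?D = chi3_sum m" by (simp add: chi3_sum_def)
  ultimately show ?thesis using sum_E[of m] by (simp add: algebra_simps)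
qed

text \<open>Strong induction, removing one prime factor at a time; the six units are the base
  case.\<close>

lemma card_eis_shell:
  assumes "n > 0" "\<not> 3 dvd n"
  shows "int (card (eis_shell n)) = 6 * chi3_sum n"
  using assms
proof (induction n rule: less_induct)
  case (less n)
  show ?case
  proof (cases "n = 1")
    case True
    have "chi3_sum 1 = 1" by (simp add: chi3_sum_def chi3_def)
    then show ?thesis using True card_eis_shell_1 by simp
  next
    case False
    then obtain p where p: "prime p" "p dvd n" using prime_factor_nat by blast
    then obtain m where n: "n = p * m" by blast
    have m0: "m > 0" and p0: "p > 1" using less.prems n p(1) prime_gt_1_nat by auto
    have m3: "\<not> 3 dvd m" and p3: "p \<noteq> 3" using less.prems(2) n by auto
    have IHm: "int (card (eis_shell m)) = 6 * chi3_sum m"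
      using less.IH[of m] m0 m3 p0 n by simp
    define K where "K = (if p dvd m then card (eis_shell (m div p)) else 0)"
    define L where "L = (if p dvd m then chi3_sum (m div p) else 0)"
    have IHd: "int K = 6 * L"
    proof (cases "p dvd m")
      case True
      then obtain l where l: "m = p * l" by blast
      have "l < m" "m < n" using m0 p0 l n by simp_all
      then have "l < n" by simp
      moreover have "\<not> 3 dvd l" using m3 l dvd_mult by blast
      ultimately show ?thesis using less.IH[of l] m0 p0 l by (simp add: K_def L_def)
    qed (simp add: K_def L_def)
    note chi = chi3_sum_prime_mult[OF p(1) m0, folded L_def]
    have "\<not> 3 dvd p" using p3 p(1) primes_dvd_imp_eq[of 3 p] by auto
    then consider "p mod 3 = 1" "chi3 p = 1" | "p mod 3 = 2" "chi3 p = - 1"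
      using chi3_cases[of p] by auto
    then show ?thesis
    proof cases
      case 1
      obtain c where "eis_norm c = int p" using split_prime_is_norm[OF p(1) 1(1)] .
      from card_eis_shell_split[OF p(1) p3 this, of m]
      have "card (eis_shell n) + K = 2 * card (eis_shell m)" unfolding K_def n .
      then have "int (card (eis_shell n)) + 6 * L = 12 * chi3_sum m" using IHm IHd by linarith
      moreover have "chi3_sum n + L = 2 * chi3_sum m" using chi 1(2) n by simp
      ultimately show ?thesis by linarith
    next
      case 2
      have "int (card (eis_shell n)) = 6 * L"
        using card_eis_shell_inert[OF p(1) 2(1), of m] n IHd by (simp add: K_def)
      moreover have "chi3_sum n = L" using chi 2(2) n by simp
      ultimately show ?thesis by linarith
    qed
  qed
qed

section \<open>Counting 3-cores\<close>

text \<open>The size polynomial of \<open>sum_list_core3\<close>, extended to all integer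
  pairs.\<close>

fun core3_size :: "int \<times> int \<Rightarrow> int" where
  "core3_size (i, j) = i\<^sup>2 - i * j + j\<^sup>2 + j"

text \<open>Finiteness is assumed here; in \<open>card_eis_shell_cores3\<close> it is supplied by a
  bijection with part of a finite shell.\<close>

lemma card_core3_size:
  assumes "finite {z. core3_size z = int m}"
  shows "card {z. core3_size z = int m} = 3 * card (cores3 m)"
proof -
  let ?F = "{z. core3_size z = int m}"
  \<comment> \<open>Strict and weak inequalities are distributed so that the three regions partition
    the plane and are permuted exactly.\<close>
  define Q0 where "Q0 = {(i, j) \<in> ?F. 0 \<le> i \<and> 0 \<le> j}"
  define Q1 where "Q1 = {(i, j) \<in> ?F. j < 0 \<and> j < i}"
  define Q2 where "Q2 = {(i, j) \<in> ?F. i < 0 \<and> i \<le> j}"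
  \<comment> \<open>an affine symmetry of order three of the size form; the quadrant \<open>Q0\<close> is a fundamental domain\<close>
  define \<rho> :: "int \<times> int \<Rightarrow> int \<times> int" where "\<rho> = (\<lambda>(i, j). (j - i, - i - 1))"
  have \<rho>: "core3_size (\<rho> z) = core3_size z" "\<rho> (\<rho> (\<rho> z)) = z" for z
    by (cases z; simp add: \<rho>_def power2_eq_square algebra_simps)+
  have Q: "\<rho> z \<in> Q1 \<longleftrightarrow> z \<in> Q0" "\<rho> z \<in> Q2 \<longleftrightarrow> z \<in> Q1" "\<rho> z \<in> Q0 \<longleftrightarrow> z \<in> Q2" for z
    using \<rho>(1)[of z] by (cases z; auto simp: Q0_def Q1_def Q2_def \<rho>_def simp del: core3_size.simps)+
  have "bij_betw \<rho> Q0 Q1" "bij_betw \<rho> Q1 Q2"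
    by (rule bij_betw_byWitness[where f' = "\<lambda>z. \<rho> (\<rho> z)"]; auto simp: Q \<rho>(2))+
  then have eq: "card Q1 = card Q0" "card Q2 = card Q0"
    by (simp_all add: bij_betw_same_card[symmetric])
  have fin: "finite Q0" "finite Q1" "finite Q2"
    by (rule finite_subset[OF _ assms], force simp: Q0_def Q1_def Q2_def)+
  have "?F = Q0 \<union> (Q1 \<union> Q2)" "Q0 \<inter> (Q1 \<union> Q2) = {}" "Q1 \<inter> Q2 = {}"
    by (auto simp: Q0_def Q1_def Q2_def)
  then have "card ?F = card Q0 + (card Q1 + card Q2)"
    using fin by (simp add: card_Un_disjoint)
  moreover have "card Q0 = card (cores3 m)"
  proof -
    obtain f where f: "bij_betw f (cores3 m)
        {(i::nat, j::nat). (int i)\<^sup>2 - int i * int j + (int j)\<^sup>2 + int j = int m}"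
      using bij_cores3 by blast
    have g: "bij_betw (\<lambda>(i, j). (int i, int j))
        {(i::nat, j::nat). (int i)\<^sup>2 - int i * int j + (int j)\<^sup>2 + int j = int m} Q0"
      by (rule bij_betw_byWitness[where f' = "\<lambda>(i, j). (nat i, nat j)"]) (auto simp: Q0_def)
    show ?thesis using bij_betw_same_card[OF f] bij_betw_same_card[OF g] by simp
  qed
  ultimately show ?thesis using eq by simp
qed

text \<open>The factor 6 is 2 times 3: negation exchanges the classes 1 and 2 of x + y modulo 3, and
  class 1 is parametrised by the integer solutions counted in
  \<open>card_core3_size\<close>.\<close>

lemma card_eis_shell_cores3: "card (eis_shell (3 * m + 1)) = 6 * card (cores3 m)"
proof -
  let ?n = "3 * m + 1" and ?F = "{z. core3_size z = int m}"
  define P where "P = {(x, y) \<in> eis_shell ?n. (x + y) mod 3 = 1}"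
  define N where "N = {(x, y) \<in> eis_shell ?n. (x + y) mod 3 = 2}"
  have fin: "finite P" "finite N"
    by (rule finite_subset[OF _ finite_eis_shell[of ?n]], force simp: P_def N_def)+
  \<comment> \<open>If 3 divides x + y, it divides the norm, which is 1 modulo 3.\<close>
  have nz: "(x + y) mod 3 \<noteq> 0" if "(x, y) \<in> eis_shell ?n" for x y
  proof
    assume "(x + y) mod 3 = 0"
    then obtain k where "x + y = 3 * k" by auto
    then have "x = 3 * k - y" by simp
    then have "eis_norm (3 * k - y, y) = 3 * int m + 1"
      using that by (simp add: eis_shell_def del: eis_norm.simps)
    moreover have "eis_norm (3 * k - y, y) = 3 * (3 * k\<^sup>2 - 3 * k * y + y\<^sup>2)"
      by (simp add: power2_eq_square algebra_simps)
    ultimately show False by presburger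
  qed
  have "(x + y) mod 3 = 1 \<or> (x + y) mod 3 = 2" if "(x, y) \<in> eis_shell ?n" for x y
    using nz[OF that] by presburger
  then have "eis_shell ?n = P \<union> N" unfolding P_def N_def by auto
  moreover have "P \<inter> N = {}" by (auto simp: P_def N_def)
  ultimately have "card (eis_shell ?n) = card P + card N" using fin by (simp add: card_Un_disjoint)
  moreover have "card P = card N"
  proof -
    have neg: "t mod 3 = 1 \<longleftrightarrow> (- t) mod 3 = 2" for t :: int by presburger
    have "(x, y) \<in> P \<longleftrightarrow> (- x, - y) \<in> N" for x y
      using neg[of "y + x"] by (simp add: add.commute[of x y] P_def N_def eis_shell_def)
    then have "bij_betw (\<lambda>(x, y). (- x, - y)) P N"
      by (intro bij_betw_byWitness[where f' = "\<lambda>(x, y). (- x, - y)"]) auto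
    then show ?thesis by (rule bij_betw_same_card)
  qed
  moreover have bij: "bij_betw (\<lambda>(i, j). (i + j + 1, 2 * i - j)) ?F P"
  proof (rule bij_betw_imageI)
    show "inj_on (\<lambda>(i, j). (i + j + 1, 2 * i - j)) ?F" by (auto simp: inj_on_def)
    have norm: "eis_norm (i + j + 1, 2 * i - j) = 3 * core3_size (i, j) + 1" for i j
      by (simp add: power2_eq_square algebra_simps)
    show "(\<lambda>(i, j). (i + j + 1, 2 * i - j)) ` ?F = P"
    proof (intro equalityI subsetI)
      fix z assume "z \<in> (\<lambda>(i, j). (i + j + 1, 2 * i - j)) ` ?F"
      then obtain i j where z: "z = (i + j + 1, 2 * i - j)" "core3_size (i, j) = int m" by auto
      have "i + j + 1 + (2 * i - j) = 3 * i + 1" by simp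
      moreover have "(3 * i + 1) mod 3 = 1" by presburger
      ultimately show "z \<in> P" using z norm[of i j] unfolding P_def eis_shell_def
        by (simp del: eis_norm.simps core3_size.simps)
    next
      fix z assume "z \<in> P"
      then obtain x y where z: "z = (x, y)" "(x, y) \<in> eis_shell ?n" "(x + y) mod 3 = 1"
        by (auto simp: P_def)
      \<comment> \<open>Inverse of the parametrisation: its coordinates add up to 3i + 1.\<close>
      define i where "i = (x + y) div 3"
      define j where "j = x - 1 - i"
      have "x + y = 3 * i + 1" using z(3) unfolding i_def by presburger
      then have xy: "x = i + j + 1" "y = 2 * i - j" by (simp_all add: j_def)
      then have "3 * core3_size (i, j) + 1 = 3 * int m + 1"
        using z(2) norm[of i j] unfolding xy eis_shell_def by (simp del: eis_norm.simps core3_size.simps)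
      then have "(i, j) \<in> ?F" by (simp del: core3_size.simps)
      then show "z \<in> (\<lambda>(i, j). (i + j + 1, 2 * i - j)) ` ?F"
        unfolding z(1) xy by (rule rev_image_eqI) simp
    qed
  qed
  moreover have "card ?F = 3 * card (cores3 m)"
    using card_core3_size bij_betw_finite[OF bij] fin(1) by blast
  ultimately show ?thesis using bij_betw_same_card[OF bij] by simp
qed

lemma card_cores3: "int (card (cores3 m)) = chi3_sum (3 * m + 1)"
proof -
  have "\<not> 3 dvd 3 * m + 1" by presburger
  then have "int (card (eis_shell (3 * m + 1))) = 6 * chi3_sum (3 * m + 1)"
    by (intro card_eis_shell) simp_all
  then show ?thesis unfolding card_eis_shell_cores3 by simp
qed

lemma finite_cores3: "finite (cores3 m)"
proof (rule finite_subset)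
  have "length xs \<le> sum_list xs" if "is_partition xs" for xs
    using that by (induction xs) (auto simp: is_partition_Cons)
  then show "cores3 m \<subseteq> {xs. set xs \<subseteq> {..m} \<and> length xs \<le> m}"
    by (auto simp: cores3_def member_le_sum_list)
qed (simp add: finite_lists_length_le)

section \<open>Pairs of 3-cores\<close>

lemma A3_convolution: "A3 n = (\<Sum>m\<le>n. card (cores3 m) * card (cores3 (n - m)))"
proof -
  have "{(a, b). is_partition a \<and> is_partition b \<and> is_core 3 a \<and> is_core 3 b \<and> sum_list a + sum_list b = n}
      = (\<Union>m\<le>n. cores3 m \<times> cores3 (n - m))"
    by (auto simp: cores3_def)
  then have "A3 n = card (\<Union>m\<le>n. cores3 m \<times> cores3 (n - m))" unfolding A3_def by simp
  also have "\<dots> = (\<Sum>m\<le>n. card (cores3 m \<times> cores3 (n - m)))"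
    by (rule card_UN_disjoint) (use finite_cores3 in \<open>auto simp: cores3_def\<close>)
  finally show ?thesis by (simp add: card_cartesian_product)
qed

theorem theorem2p2:
  fixes n :: nat
  shows "real (A3 n) = real (sigma (3 * n + 2)) / 3"
proof -
  let ?N = "3 * n + 2"
  have "int (A3 n) = (\<Sum>m\<le>n. chi3_sum (3 * m + 1) * chi3_sum (?N - (3 * m + 1)))"
    unfolding A3_convolution of_nat_sum of_nat_mult card_cores3
    by (intro sum.cong refl) (auto simp: Suc_diff_le algebra_simps diff_mult_distrib2)
  also have "\<dots> = (\<Sum>u\<in>(\<lambda>m. 3 * m + 1) ` {..n}. chi3_sum u * chi3_sum (?N - u))"
    by (subst sum.reindex) (auto simp: inj_on_def)
  \<comment> \<open>The added terms vanish: if \<open>u\<close> is not 1 modulo 3, then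
    \<open>u\<close> or its complement is 2 modulo 3, where \<open>chi3_sum\<close> is 0.\<close>
  also have "\<dots> = (\<Sum>u\<in>{0<..<?N}. chi3_sum u * chi3_sum (?N - u))"
  proof (rule sum.mono_neutral_left)
    show "\<forall>u\<in>{0<..<?N} - (\<lambda>m. 3 * m + 1) ` {..n}. chi3_sum u * chi3_sum (?N - u) = 0"
    proof
      fix u assume u: "u \<in> {0<..<?N} - (\<lambda>m. 3 * m + 1) ` {..n}"
      have "u mod 3 \<noteq> 1"
      proof
        assume "u mod 3 = 1"
        moreover have "u < 3 * n + 2" using u by simp
        ultimately have "u = 3 * (u div 3) + 1" "u div 3 \<le> n" by presburger+
        then have "u \<in> (\<lambda>m. 3 * m + 1) ` {..n}" by blast
        then show False using u by blast
      qed
      moreover have "(?N - u) mod 3 = 2" if "u mod 3 = 0"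
      proof -
        have "3 dvd u" using that by (rule mod_0_imp_dvd)
        then obtain k where "u = 3 * k" by blast
        moreover have "u < 3 * n + 2" using u by simp
        ultimately have "?N - u = 3 * (n - k) + 2" by linarith
        moreover have "(3 * j + 2) mod 3 = 2" for j :: nat by presburger
        ultimately show ?thesis by metis
      qed
      moreover have "u mod 3 = 0 \<or> u mod 3 = 1 \<or> u mod 3 = 2" by presburger
      ultimately have "u mod 3 = 2 \<or> (?N - u) mod 3 = 2" by (elim disjE) simp_all
      then show "chi3_sum u * chi3_sum (?N - u) = 0" using chi3_sum_eq_0 by auto
    qed
  qed auto
  finally have A3: "int (A3 n) = (\<Sum>u\<in>{0<..<?N}. chi3_sum u * chi3_sum (?N - u))" .
  have "?N mod 3 = 2" by presburger
  then have "3 * int (A3 n) = int (sigma ?N)"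
    unfolding A3 by (rule liouville_convolution)
  then have "3 * real (A3 n) = real (sigma ?N)" by linarith
  then show ?thesis by simp
qed

end
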